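(* Let $\Pi$ be a countable sampling family. Suppose $T:\mathbb N_0\curvearrowright X$ has the Very Weak Specification Property. Then the set $$X^\Pi=\left\{x\in X:\operatorname{LS}\left(\left(\mu_{x,\pi(k)}\right)_{k=1}^\infty\right)=\mathcal M_T(X)\text{ for all }\pi\in\Pi\right\}$$ is residual in $X$.
   Context: $(X,\rho)$ is a compact metric space and $T:\mathbb N_0\curvearrowright X$ is an action of the additive monoid $\mathbb N_0$ of nonnegative integers by continuous, not necessarily invertible, maps $(T_j)_{j\in\mathbb N_0}$ ($T_i\circ T_j=T_{i+j}$, $T_0=\mathrm{id}_X$). $\mathbb N$ is the set of positive integers. $\mathcal M(X)$ is the space of Borel probability measures on $X$ with the weak* topology and $\mathcal M_T(X)$ is the subspace of $T$-invariant ones. For $x\in X$, $k\in\mathbb N$, the $k$th empirical measure is $\mu_{x,k}=\frac1k\sum_{j=0}^{k-1}\delta_{T_jx}$, with $\delta_y$ the point mass at $y$. For a sequence $(z_k)_{k=1}^\infty$, $\operatorname{LS}((z_k)_{k=1}^\infty)$ is the set of all limits of convergent subsequences (here in $\mathcal M(X)$). A subset of $X$ is residual if it contains a dense $G_\delta$ set. A sampling family is a family $\Pi$ of functions $\pi:\mathbb N\to\mathbb N$ such that $\lim_{k\to\infty}\pi(k)=+\infty$ for all $\pi\in\Pi$. A specification is a finite sequence $\xi=\{([a_j,b_j],x_j)\}_{j=1}^n$ of finite (integer) subintervals $[a_j,b_j]$ of $\mathbb N$ and points $x_j\in X$. Given $\mathbf M:\mathbb N\to\mathbb N$, $\xi$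 is $\mathbf M$-spaced if $a_j-b_{j-1}\ge\mathbf M(j)$ for all $j=2,\ldots,n$. For $\delta>0$, a point $y\in X$ is a $\delta$-tracing of $\xi$ if $\rho(T_ix_j,T_{a_j+i}y)<\delta$ for all $j=1,\ldots,n$ and $i=0,1,\ldots,b_j-a_j$. $T$ has the Very Weak Specification Property if there is a family of functions $(\mathbf M_\delta:\mathbb N\to\mathbb N)_{\delta\in(0,1)}$ such that for every $\delta\in(0,1)$ every $\mathbf M_\delta$-spaced specification admits a $\delta$-tracing. *)

theory Defs
  imports "HOL-Probability.Probability"
begin

definition N0_action :: "(nat \<Rightarrow> 'a::metric_space \<Rightarrow> 'a) \<Rightarrow> bool" where
  "N0_action T \<longleftrightarrow>
     T 0 = id \<and> (\<forall>i j. T i \<circ> T j = T (i + j)) \<and> (\<forall>j. continuous_on UNIV (T j))"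

definition borel_probs :: "'a::metric_space measure set" where
  "borel_probs = {\<mu>. sets \<mu> = sets borel \<and> prob_space \<mu>}"

definition invariant_probs :: "(nat \<Rightarrow> 'a::metric_space \<Rightarrow> 'a) \<Rightarrow> 'a measure set" where
  "invariant_probs T = {\<mu> \<in> borel_probs. \<forall>j. distr \<mu> borel (T j) = \<mu>}"

text \<open>The coarsest topology on the Borel probability measures for which integration against each
  continuous function is continuous. No boundedness is demanded of the test functions, as the
  topology is only used on compact spaces.\<close>

definition weak_star :: "'a::metric_space measure topology" where
  "weak_star = pullback_topology borel_probs
     (\<lambda>\<mu>. \<lambda>f\<in>{f. continuous_on UNIV f}. integral\<^sup>L \<mu> f)
     (product_topology (\<lambda>_. euclideanreal) {f. continuous_on UNIV f})"

definition empirical_measure :: "(nat \<Rightarrow> 'a::metric_space \<Rightarrow> 'a) \<Rightarrow> 'a \<Rightarrow> nat \<Rightarrow> 'a measure" where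
  "empirical_measure T x k = measure_of UNIV (sets borel)
     (\<lambda>A. ennreal (1 / real k) * (\<Sum>j<k. emeasure (return borel (T j x)) A))"

text \<open>Sequences are indexed by the positive integers, so the value \<open>z 0\<close> is never used.\<close>

definition LS :: "'b topology \<Rightarrow> (nat \<Rightarrow> 'b) \<Rightarrow> 'b set" where
  "LS \<tau> z = {l. \<exists>r. strict_mono r \<and> (\<forall>i. 1 \<le> r i) \<and> limitin \<tau> (\<lambda>i. z (r i)) l sequentially}"

definition residual :: "'a::topological_space set \<Rightarrow> bool" where
  "residual A \<longleftrightarrow> (\<exists>G. gdelta G \<and> closure G = UNIV \<and> G \<subseteq> A)"

text \<open>A function from the positive integers to the positive integers is a function on \<open>nat\<close> that
  is positive at positive arguments; its value at 0 is irrelevant.\<close>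

definition sampling_family :: "(nat \<Rightarrow> nat) set \<Rightarrow> bool" where
  "sampling_family \<P> \<longleftrightarrow>
     (\<forall>\<pi>\<in>\<P>. (\<forall>k\<ge>1. 1 \<le> \<pi> k) \<and> filterlim \<pi> at_top sequentially)"

text \<open>A specification of length \<open>n\<close> consists of the intervals \<open>[a j, b j]\<close> and the points \<open>x j\<close> for
  \<open>j = 1, ..., n\<close>; values at other indices are irrelevant.\<close>

definition specification_intervals :: "nat \<Rightarrow> (nat \<Rightarrow> nat) \<Rightarrow> (nat \<Rightarrow> nat) \<Rightarrow> bool" where
  "specification_intervals n a b \<longleftrightarrow> (\<forall>j\<in>{1..n}. 1 \<le> a j \<and> a j \<le> b j)"

definition spaced :: "(nat \<Rightarrow> nat) \<Rightarrow> nat \<Rightarrow> (nat \<Rightarrow> nat) \<Rightarrow> (nat \<Rightarrow> nat) \<Rightarrow> bool" where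
  "spaced M n a b \<longleftrightarrow> (\<forall>j\<in>{2..n}. int (a j) - int (b (j - 1)) \<ge> int (M j))"

definition tracing ::
  "(nat \<Rightarrow> 'a::metric_space \<Rightarrow> 'a) \<Rightarrow> real \<Rightarrow>
     nat \<Rightarrow> (nat \<Rightarrow> nat) \<Rightarrow> (nat \<Rightarrow> nat) \<Rightarrow> (nat \<Rightarrow> 'a) \<Rightarrow> 'a \<Rightarrow> bool" where
  "tracing T \<delta> n a b x y \<longleftrightarrow>
     (\<forall>j\<in>{1..n}. \<forall>i\<in>{0..b j - a j}. dist (T i (x j)) (T (a j + i) y) < \<delta>)"

definition very_weak_specification :: "(nat \<Rightarrow> 'a::metric_space \<Rightarrow> 'a) \<Rightarrow> bool" where
  "very_weak_specification T \<longleftrightarrow>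
     (\<exists>M :: real \<Rightarrow> nat \<Rightarrow> nat.
        (\<forall>\<delta>\<in>{0<..<1}. \<forall>j\<ge>1. 1 \<le> M \<delta> j) \<and>
        (\<forall>\<delta>\<in>{0<..<1}. \<forall>n a b x. specification_intervals n a b \<and> spaced (M \<delta>) n a b \<longrightarrow>
           (\<exists>y. tracing T \<delta> n a b x y)))"

definition sampled_generic_points ::
  "(nat \<Rightarrow> 'a::metric_space \<Rightarrow> 'a) \<Rightarrow> (nat \<Rightarrow> nat) set \<Rightarrow> 'a set" where
  "sampled_generic_points T \<P> =
     {x. \<forall>\<pi>\<in>\<P>. LS weak_star (\<lambda>k. empirical_measure T x (\<pi> k)) = invariant_probs T}"

lemma space_empirical_measure [simp]: "space (empirical_measure T x k) = UNIV"
  and sets_empirical_measure [simp, measurable_cong]: "sets (empirical_measure T x k) = sets borel"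
proof -
  have eq: "sigma_sets UNIV (sets (borel :: 'a measure)) = sets borel"
    using sets.sigma_sets_eq[of "borel :: 'a measure"] by simp
  show "space (empirical_measure T x k) = UNIV"
    unfolding empirical_measure_def by (simp add: space_measure_of_conv)
  show "sets (empirical_measure T x k) = sets borel"
    unfolding empirical_measure_def by (simp add: sets_measure_of_conv eq)
qed

lemma emeasure_empirical_measure:
  assumes "A \<in> sets borel"
  shows "emeasure (empirical_measure T x k) A =
    ennreal (1 / real k) * (\<Sum>j<k. indicator A (T j x))"
proof -
  let ?\<mu> = "\<lambda>A. ennreal (1 / real k) * (\<Sum>j<k. emeasure (return borel (T j x)) A)"
  have "countably_additive (sets borel) ?\<mu>"
    unfolding countably_additive_def
  proof (intro allI impI)
    fix F :: "nat \<Rightarrow> 'a set"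
    assume F: "range F \<subseteq> sets borel" "disjoint_family F"
    have "(\<Sum>i. ?\<mu> (F i)) = ennreal (1 / real k) * (\<Sum>j<k. \<Sum>i. emeasure (return borel (T j x)) (F i))"
      by (simp add: suminf_sum)
    also have "\<dots> = ?\<mu> (\<Union>i. F i)"
      using F by (intro arg_cong2[where f="(*)"] sum.cong refl suminf_emeasure) auto
    finally show "(\<Sum>i. ?\<mu> (F i)) = ?\<mu> (\<Union>i. F i)" .
  qed
  then have "emeasure (empirical_measure T x k) A = ?\<mu> A"
    using assms sets.sigma_sets_eq[of "borel :: 'a measure"]
    by (intro emeasure_measure_of[OF empirical_measure_def])
      (auto simp: positive_def)
  with assms show ?thesis by simp
qed

lemma empirical_measure_in_borel_probs:
  assumes "1 \<le> k"
  shows "empirical_measure T x k \<in> borel_probs"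
proof -
  have "emeasure (empirical_measure T x k) UNIV = ennreal (1 / real k) * ennreal (real k)"
    by (simp add: emeasure_empirical_measure ennreal_of_nat_eq_real_of_nat)
  also have "\<dots> = 1"
    using assms by (simp flip: ennreal_mult)
  finally show ?thesis
    by (auto simp: borel_probs_def intro!: prob_spaceI)
qed

lemma topspace_weak_star [simp]: "topspace weak_star = borel_probs"
  by (auto simp: weak_star_def topspace_pullback_topology)

lemma limitin_weak_star:
  fixes \<mu> :: "'a::metric_space measure"
  shows "limitin weak_star z \<mu> sequentially \<longleftrightarrow>
     \<mu> \<in> borel_probs \<and> (\<forall>\<^sub>F k in sequentially. z k \<in> borel_probs) \<and>
     (\<forall>f :: _ \<Rightarrow> real. continuous_on UNIV f \<longrightarrow> (\<lambda>k. integral\<^sup>L (z k) f) \<longlonglongrightarrow> integral\<^sup>L \<mu> f)"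
  (is "?L \<longleftrightarrow> ?R")
proof -
  let ?C = "{f :: 'a \<Rightarrow> real. continuous_on UNIV f}"
  let ?h = "\<lambda>\<mu>. \<lambda>f\<in>?C. integral\<^sup>L \<mu> f"
  let ?P = "product_topology (\<lambda>_. euclideanreal) ?C"
  have "?L \<longleftrightarrow> \<mu> \<in> borel_probs \<and> (\<forall>\<^sub>F k in sequentially. z k \<in> borel_probs) \<and>
      limitin ?P (\<lambda>k. ?h (z k)) (?h \<mu>) sequentially"
  proof
    assume L: ?L
    have mu: "\<mu> \<in> borel_probs" using limitin_topspace[OF L] by simp
    have "\<forall>\<^sub>F k in sequentially. z k \<in> borel_probs"
      using L mu openin_topspace[of weak_star] unfolding limitin_def by auto
    moreover have "limitin ?P (\<lambda>k. ?h (z k)) (?h \<mu>) sequentially"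
      unfolding limitin_def
    proof (intro conjI allI impI)
      show "?h \<mu> \<in> topspace ?P" by simp
      fix U assume U: "openin ?P U \<and> ?h \<mu> \<in> U"
      then have "openin weak_star (?h -` U \<inter> borel_probs)"
        unfolding weak_star_def openin_pullback_topology by blast
      with L mu U have "\<forall>\<^sub>F k in sequentially. z k \<in> ?h -` U \<inter> borel_probs"
        unfolding limitin_def by blast
      then show "\<forall>\<^sub>F k in sequentially. ?h (z k) \<in> U"
        by (rule eventually_mono) simp
    qed
    ultimately show "\<mu> \<in> borel_probs \<and> (\<forall>\<^sub>F k in sequentially. z k \<in> borel_probs) \<and>
      limitin ?P (\<lambda>k. ?h (z k)) (?h \<mu>) sequentially" using mu by blast
  next
    assume R: "\<mu> \<in> borel_probs \<and> (\<forall>\<^sub>F k in sequentially. z k \<in> borel_probs) \<and>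
      limitin ?P (\<lambda>k. ?h (z k)) (?h \<mu>) sequentially"
    show ?L
      unfolding limitin_def
    proof (intro conjI allI impI)
      show "\<mu> \<in> topspace weak_star" using R by simp
      fix V assume V: "openin weak_star V \<and> \<mu> \<in> V"
      then obtain U where U: "openin ?P U" "V = ?h -` U \<inter> borel_probs"
        unfolding weak_star_def openin_pullback_topology by blast
      with R V have "\<forall>\<^sub>F k in sequentially. ?h (z k) \<in> U"
        unfolding limitin_def by blast
      with R have "\<forall>\<^sub>F k in sequentially. ?h (z k) \<in> U \<and> z k \<in> borel_probs"
        by (simp add: eventually_conj_iff)
      then show "\<forall>\<^sub>F k in sequentially. z k \<in> V"
        by (rule eventually_mono) (simp add: U)
    qed
  qed
  also have "\<dots> \<longleftrightarrow> ?R"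
    by (simp add: limitin_componentwise)
  finally show ?thesis .
qed

end

theory Submission
  imports Defs
begin

text \<open>Let \<open>\<nu>\<close> be invariant. Finitely many continuous functions satisfy
  \<open>\<integral> f d\<nu> = \<integral> A\<^sub>L f d\<nu>\<close>, where \<open>A\<^sub>L\<close> is the Birkhoff average of length \<open>L\<close>, so a variance estimate
  yields points \<open>x\<^sub>1, ..., x\<^sub>m\<close> for which the mean of the \<open>A\<^sub>L f (x\<^sub>s)\<close> is close to \<open>\<integral> f d\<nu>\<close>. The number
  \<open>m\<close> depends on the tolerance but not on \<open>L\<close>; hence the gaps needed to trace the \<open>m\<close> orbit segments of
  length \<open>L\<close> one after another are negligible once \<open>L\<close> is large, and no ergodic theorem is needed.
  The tracing point can be taken close to any given point, and its average over any prescribed long time is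
  close to \<open>\<nu>\<close>. As weak* convergence is tested on countably many functions, whose integrals can be
  approximated by rationals, Baire's theorem gives a residual set of points along whose orbits every
  invariant measure is a limit. Conversely every limit of empirical measures is invariant.\<close>

section \<open>Borel probability measures tested on continuous functions\<close>

definition birkhoff_average :: "(nat \<Rightarrow> 'a \<Rightarrow> 'a) \<Rightarrow> ('a \<Rightarrow> real) \<Rightarrow> nat \<Rightarrow> 'a \<Rightarrow> real" where
  "birkhoff_average T f n x = (\<Sum>j<n. f (T j x)) / real n"

lemma bounded_continuous_real:
  fixes f :: "'a::topological_space \<Rightarrow> real"
  assumes "compact (UNIV :: 'a set)" "continuous_on UNIV f"
  obtains C where "C > 0" "\<And>x. \<bar>f x\<bar> \<le> C"
proof -
  have "bounded (range f)"
    using assms by (intro compact_imp_bounded compact_continuous_image)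
  then show ?thesis
    using that unfolding bounded_pos by auto
qed

lemma integrable_continuous_borel_probs:
  fixes f :: "'a::metric_space \<Rightarrow> real"
  assumes "compact (UNIV :: 'a set)" "continuous_on UNIV f" "\<mu> \<in> borel_probs"
  shows "integrable \<mu> f"
proof -
  interpret prob_space \<mu> using assms(3) by (simp add: borel_probs_def)
  have [measurable_cong]: "sets \<mu> = sets borel" using assms(3) by (simp add: borel_probs_def)
  have [measurable]: "f \<in> borel_measurable borel"
    using assms(2) by (rule borel_measurable_continuous_onI)
  obtain C where "\<And>x. \<bar>f x\<bar> \<le> C" using bounded_continuous_real[OF assms(1,2)] by blast
  then show ?thesis by (intro integrable_const_bound[where B = C]) auto
qed

text \<open>Closed sets form an intersection-stable generator of the Borel sets, so agreement on
  them suffices. The indicator of a closed set \<open>K\<close> is the pointwise limit of the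
  continuous functions \<open>max 0 (1 - n * infdist x K)\<close>, and dominated convergence carries
  the equality of integrals over to it.\<close>

lemma borel_probs_eqI:
  fixes \<mu> \<nu> :: "'a::metric_space measure"
  assumes mu: "\<mu> \<in> borel_probs" and nu: "\<nu> \<in> borel_probs"
    and eq: "\<And>f :: 'a \<Rightarrow> real. continuous_on UNIV f \<Longrightarrow> integral\<^sup>L \<mu> f = integral\<^sup>L \<nu> f"
  shows "\<mu> = \<nu>"
proof -
  interpret mu: prob_space \<mu> using mu by (simp add: borel_probs_def)
  interpret nu: prob_space \<nu> using nu by (simp add: borel_probs_def)
  have smu [measurable_cong]: "sets \<mu> = sets borel" and snu [measurable_cong]: "sets \<nu> = sets borel"
    using mu nu by (simp_all add: borel_probs_def)
  \<comment> \<open>The empty set is treated apart because \<open>infdist x {} = 0\<close>, which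
    would make every \<open>g n\<close> constantly 1.\<close>
  have closed_eq: "emeasure \<mu> K = emeasure \<nu> K" if "closed K" for K
  proof (cases "K = {}")
    case False
    define g where "g n x = max 0 (1 - real n * infdist x K)" for n x
    have cg: "continuous_on UNIV (g n)" for n
      unfolding g_def by (intro continuous_intros)
    then have [measurable]: "g n \<in> borel_measurable borel" for n
      by (rule borel_measurable_continuous_onI)
    have bd: "norm (g n x) \<le> 1" for n x
      by (simp add: g_def infdist_nonneg)
    have lim: "(\<lambda>n. g n x) \<longlonglongrightarrow> indicator K x" for x
    proof (cases "x \<in> K")
      case True
      then show ?thesis by (simp add: g_def)
    next
      case F: False
      then have pos: "infdist x K > 0"
        using that \<open>K \<noteq> {}\<close> by (simp add: infdist_pos_not_in_closed)
      obtain N :: nat where N: "1 / infdist x K < real N"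
        using reals_Archimedean2 by blast
      have "g n x = 0" if "N \<le> n" for n
      proof -
        have "1 / infdist x K \<le> real n" using N that by linarith
        then show ?thesis using pos by (simp add: g_def field_simps)
      qed
      then show ?thesis
        using F by (intro tendsto_eventually) (auto simp: eventually_sequentially)
    qed
    have [measurable]: "K \<in> sets borel" using that by simp
    have "(\<lambda>n. integral\<^sup>L \<mu> (g n)) \<longlonglongrightarrow> integral\<^sup>L \<mu> (indicator K)"
      by (rule integral_dominated_convergence[where w = "\<lambda>_. 1"]) (use lim bd in auto)
    moreover have "(\<lambda>n. integral\<^sup>L \<nu> (g n)) \<longlonglongrightarrow> integral\<^sup>L \<nu> (indicator K)"
      by (rule integral_dominated_convergence[where w = "\<lambda>_. 1"]) (use lim bd in auto)
    ultimately have "integral\<^sup>L \<mu> (indicator K :: 'a \<Rightarrow> real) = integral\<^sup>L \<nu> (indicator K)"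
      using eq[OF cg] by (simp add: LIMSEQ_unique)
    then show ?thesis
      using \<open>K \<in> sets borel\<close> by (simp add: smu snu mu.emeasure_eq_measure nu.emeasure_eq_measure)
  qed simp
  show ?thesis
  proof (rule measure_eqI_generator_eq[where E = "Collect closed" and \<Omega> = UNIV and A = "\<lambda>_. UNIV"])
    show "Int_stable (Collect closed :: 'a set set)"
      by (simp add: Int_stable_def closed_Int)
  qed (auto simp: smu snu borel_eq_closed closed_eq)
qed

text \<open>Seen as an image of the uniform distribution on \<open>{..<k}\<close>, the empirical
  measure has integrals that reduce to finite averages by the general rules for image
  measures.\<close>

lemma empirical_measure_eq_distr:
  assumes "1 \<le> k"
  shows "empirical_measure T x k = distr (measure_pmf (pmf_of_set {..<k})) borel (\<lambda>j. T j x)"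
proof (rule measure_eqI)
  fix A assume A: "A \<in> sets (empirical_measure T x k)"
  have ne: "{..<k} \<noteq> {}" using assms by (simp add: lessThan_empty_iff)
  have "emeasure (empirical_measure T x k) A = ennreal (1 / real k) * (\<Sum>j<k. indicator A (T j x))"
    using A by (simp add: emeasure_empirical_measure)
  also have "(\<Sum>j<k. indicator A (T j x) :: ennreal) = of_nat (card ({..<k} \<inter> {j. T j x \<in> A}))"
    by (simp add: indicator_def sum.If_cases)
  also have "ennreal (1 / real k) * \<dots> = ennreal (card ({..<k} \<inter> {j. T j x \<in> A}) / real k)"
    by (simp add: ennreal_of_nat_eq_real_of_nat flip: ennreal_mult)
  also have "\<dots> = emeasure (distr (measure_pmf (pmf_of_set {..<k})) borel (\<lambda>j. T j x)) A"
    using A ne by (simp add: emeasure_distr emeasure_pmf_of_set vimage_def)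
  finally show "emeasure (empirical_measure T x k) A
    = emeasure (distr (measure_pmf (pmf_of_set {..<k})) borel (\<lambda>j. T j x)) A" .
qed simp

lemma integral_empirical_measure:
  fixes f :: "'a::metric_space \<Rightarrow> real"
  assumes "1 \<le> k" "f \<in> borel_measurable borel"
  shows "integral\<^sup>L (empirical_measure T x k) f = birkhoff_average T f k x"
proof -
  have "{..<k} \<noteq> {}" using assms by (simp add: lessThan_empty_iff)
  then show ?thesis
    using assms by (simp add: empirical_measure_eq_distr integral_distr integral_pmf_of_set
        birkhoff_average_def)
qed

section \<open>A countable family of test functions for weak* convergence\<close>

text \<open>Compactness gives a finite net at each scale \<open>1 / Suc n\<close>. Tent functions
  around the net points, divided by their sum, form a partition of unity, and weighting it with the
  values of \<open>f\<close> at the net points approximates \<open>f\<close> uniformly. The set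
  \<open>I\<close> consists of points of the space because the sum runs over a net;
  \<open>idx\<close> locates the members of the partition in one enumeration of all scales.\<close>

lemma countable_test_functions:
  assumes "compact (UNIV :: 'a::metric_space set)"
  obtains \<phi> :: "nat \<Rightarrow> 'a::metric_space \<Rightarrow> real"
  where "\<And>i. continuous_on UNIV (\<phi> i)"
    and "\<And>(f :: 'a::metric_space \<Rightarrow> real) e. continuous_on UNIV f \<Longrightarrow> e > 0 \<Longrightarrow>
      \<exists>(I :: 'a::metric_space set) c idx. finite I \<and> (\<forall>x. \<bar>f x - (\<Sum>p\<in>I. c p * \<phi> (idx p) x)\<bar> \<le> e)"
proof -
  have "\<exists>F. finite F \<and> (UNIV :: 'a set) \<subseteq> (\<Union>p\<in>F. ball p (1 / real (Suc n)))" for n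
    using assms unfolding compact_eq_totally_bounded
    by (metis of_nat_0_less_iff zero_less_Suc zero_less_divide_1_iff)
  then obtain F where fin: "\<And>n. finite (F n :: 'a set)"
    and cov: "\<And>n. UNIV \<subseteq> (\<Union>p\<in>F n. ball p (1 / real (Suc n)))"
    by metis
  define w where "w n p x = max 0 (1 / real (Suc n) - dist x p)" for n and p x :: 'a
  define \<psi> where "\<psi> = (\<lambda>(n, p) x. w n p x / (\<Sum>q\<in>F n. w n q x))"
  have w0: "0 \<le> w n p x" for n p x by (simp add: w_def)
  have spos: "0 < (\<Sum>q\<in>F n. w n q x)" for n x
  proof -
    have "x \<in> (\<Union>p\<in>F n. ball p (1 / real (Suc n)))" using cov[of n] by (rule subsetD) (rule UNIV_I)
    then obtain p where p: "p \<in> F n" "dist p x < 1 / real (Suc n)"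
      unfolding UN_iff mem_ball by blast
    then have "0 < w n p x" by (simp add: w_def dist_commute)
    then show ?thesis using p fin w0 by (intro sum_pos2) auto
  qed
  have cont: "continuous_on UNIV (\<psi> np)" for np
  proof -
    have "continuous_on UNIV (w n p)" for n p
      unfolding w_def by (intro continuous_intros)
    moreover have "(\<Sum>q\<in>F n. w n q x) \<noteq> 0" for n x
      using spos[of n x] by linarith
    ultimately have "continuous_on UNIV (\<lambda>x. w n p x / (\<Sum>q\<in>F n. w n q x))" for n p
      by (intro continuous_on_divide continuous_on_sum ballI)
    then show ?thesis by (cases np) (simp only: \<psi>_def prod.case)
  qed
  define J where "J = (SIGMA n:UNIV. F n)"
  have cJ: "countable J" unfolding J_def using fin by (auto intro: countable_finite)
  define \<phi> where "\<phi> i = \<psi> (from_nat_into J i)" for i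
  show ?thesis
  proof
    show "continuous_on UNIV (\<phi> i)" for i by (simp add: \<phi>_def cont)
    fix f :: "'a \<Rightarrow> real" and e :: real
    assume f: "continuous_on UNIV f" and e: "e > 0"
    obtain d where d: "d > 0" "\<And>x y. dist x y < d \<Longrightarrow> \<bar>f x - f y\<bar> < e"
      using uniformly_continuous_onE[OF compact_uniformly_continuous[OF f assms] e]
      unfolding dist_real_def by (metis UNIV_I)
    \<comment> \<open>At a scale finer than the modulus of continuity, only net points
      \<open>p\<close> with \<open>f p\<close> close to \<open>f x\<close> carry weight at
      \<open>x\<close>.\<close>
    obtain n where n: "1 / real (Suc n) < d"
      using d(1) nat_approx_posE by blast
    have "\<bar>f x - (\<Sum>p\<in>F n. f p * \<phi> (to_nat_on J (n, p)) x)\<bar> \<le> e" for x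
    proof -
      let ?S = "\<Sum>q\<in>F n. w n q x"
      have phi: "\<phi> (to_nat_on J (n, p)) x = w n p x / ?S" if "p \<in> F n" for p
        using that cJ by (simp add: \<phi>_def J_def \<psi>_def)
      have one: "(\<Sum>p\<in>F n. w n p x / ?S) = 1"
        using spos[where n = n and x = x] by (simp only: divide_self flip: sum_divide_distrib)
      \<comment> \<open>The weights at \<open>x\<close> sum to 1, so the error is the weighted mean
        of the differences \<open>f x - f p\<close>.\<close>
      have "f x - (\<Sum>p\<in>F n. f p * \<phi> (to_nat_on J (n, p)) x)
          = f x * (\<Sum>p\<in>F n. w n p x / ?S) - (\<Sum>p\<in>F n. f p * (w n p x / ?S))"
        by (simp only: one mult_1_right phi cong: sum.cong)
      also have "\<dots> = (\<Sum>p\<in>F n. (f x - f p) * (w n p x / ?S))"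
        by (simp only: sum_distrib_left sum_subtractf left_diff_distrib)
      also have "\<bar>\<dots>\<bar> \<le> (\<Sum>p\<in>F n. e * (w n p x / ?S))"
      proof (rule order_trans[OF sum_abs], rule sum_mono)
        fix p assume "p \<in> F n"
        have ws: "0 \<le> w n p x / ?S" using w0 spos by (simp add: less_imp_le)
        show "\<bar>(f x - f p) * (w n p x / ?S)\<bar> \<le> e * (w n p x / ?S)"
        proof (cases "w n p x = 0")
          case False
          then have "dist x p < d" using n by (auto simp: w_def max_def split: if_splits)
          then have "\<bar>f x - f p\<bar> \<le> e" using d(2) less_imp_le by blast
          then show ?thesis using ws by (simp only: abs_mult abs_of_nonneg mult_right_mono)
        qed simp
      qed
      also have "\<dots> = e" using one by (simp only: mult_1_right flip: sum_distrib_left)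
      finally show ?thesis .
    qed
    then show "\<exists>(I :: 'a set) c idx. finite I \<and> (\<forall>x. \<bar>f x - (\<Sum>p\<in>I. c p * \<phi> (idx p) x)\<bar> \<le> e)"
      by (intro exI[of _ "F n"] exI[of _ f] exI[of _ "\<lambda>p. to_nat_on J (n, p)"] conjI fin allI)
  qed
qed

lemma borel_probs_integral_diff_le:
  fixes f g :: "'a::metric_space \<Rightarrow> real"
  assumes "compact (UNIV :: 'a set)" "\<mu> \<in> borel_probs"
    and "continuous_on UNIV f" "continuous_on UNIV g" "\<And>x. \<bar>f x - g x\<bar> \<le> e"
  shows "\<bar>integral\<^sup>L \<mu> f - integral\<^sup>L \<mu> g\<bar> \<le> e"
proof -
  interpret prob_space \<mu> using assms(2) by (simp add: borel_probs_def)
  have i: "integrable \<mu> f" "integrable \<mu> g"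
    using assms integrable_continuous_borel_probs by blast+
  have "\<bar>integral\<^sup>L \<mu> f - integral\<^sup>L \<mu> g\<bar> = \<bar>\<integral>x. f x - g x \<partial>\<mu>\<bar>"
    using i by simp
  also have "\<dots> \<le> (\<integral>x. \<bar>f x - g x\<bar> \<partial>\<mu>)" by (rule integral_abs_bound)
  also have "\<dots> \<le> (\<integral>x. e \<partial>\<mu>)"
    using i assms(5) by (intro integral_mono) auto
  finally show ?thesis by (simp add: prob_space)
qed

text \<open>Convergence passes to finite linear combinations \<open>g\<close> of test functions.
  Replacing \<open>f\<close> by a uniformly close \<open>g\<close> costs at most
  \<open>e / 3\<close> for every \<open>z k\<close> and for \<open>\<mu>\<close> alike, since all of
  them are probability measures.\<close>

lemma integral_tendsto_if_test_functions:
  fixes \<phi> :: "nat \<Rightarrow> 'a::metric_space \<Rightarrow> real" and f :: "'a \<Rightarrow> real"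
  assumes comp: "compact (UNIV :: 'a set)"
    and \<phi>: "\<And>i. continuous_on UNIV (\<phi> i)"
    and dense: "\<And>(f :: 'a \<Rightarrow> real) e. continuous_on UNIV f \<Longrightarrow> e > 0 \<Longrightarrow>
      \<exists>(I :: 'a set) c idx. finite I \<and> (\<forall>x. \<bar>f x - (\<Sum>p\<in>I. c p * \<phi> (idx p) x)\<bar> \<le> e)"
    and z: "\<And>k :: nat. z k \<in> borel_probs" and mu: "\<mu> \<in> borel_probs"
    and lim: "\<And>i. (\<lambda>k. integral\<^sup>L (z k) (\<phi> i)) \<longlonglongrightarrow> integral\<^sup>L \<mu> (\<phi> i)"
    and f: "continuous_on UNIV f"
  shows "(\<lambda>k. integral\<^sup>L (z k) f) \<longlonglongrightarrow> integral\<^sup>L \<mu> f"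
proof (rule LIMSEQ_I)
  fix e :: real assume e: "e > 0"
  have "e / 3 > 0" using e by simp
  from dense[OF f this] obtain I :: "'a set" and c idx where I: "finite I"
    and le: "\<And>x. \<bar>f x - (\<Sum>p\<in>I. c p * \<phi> (idx p) x)\<bar> \<le> e / 3"
    by blast
  define g where "g x = (\<Sum>p\<in>I. c p * \<phi> (idx p) x)" for x
  have g: "continuous_on UNIV g" unfolding g_def by (intro continuous_intros \<phi>)
  have int: "integral\<^sup>L \<nu> g = (\<Sum>p\<in>I. c p * integral\<^sup>L \<nu> (\<phi> (idx p)))" if "\<nu> \<in> borel_probs" for \<nu>
    unfolding g_def using integrable_continuous_borel_probs[OF comp \<phi> that] by simp
  have "(\<lambda>k. integral\<^sup>L (z k) g) \<longlonglongrightarrow> integral\<^sup>L \<mu> g"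
    unfolding int[OF z] int[OF mu] by (intro tendsto_intros lim)
  from LIMSEQ_D[OF this \<open>e / 3 > 0\<close>]
  obtain N where N: "\<And>k. N \<le> k \<Longrightarrow> \<bar>integral\<^sup>L (z k) g - integral\<^sup>L \<mu> g\<bar> < e / 3"
    unfolding real_norm_def by blast
  have "norm (integral\<^sup>L (z k) f - integral\<^sup>L \<mu> f) < e" if "N \<le> k" for k
    using N[OF that] borel_probs_integral_diff_le[OF comp z f g le[folded g_def], of k]
      borel_probs_integral_diff_le[OF comp mu f g le[folded g_def]]
    unfolding real_norm_def by linarith
  then show "\<exists>N. \<forall>k\<ge>N. norm (integral\<^sup>L (z k) f - integral\<^sup>L \<mu> f) < e" by blast
qed

section \<open>Birkhoff averages and invariance of limit measures\<close>

lemma N0_action_add: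
  assumes "N0_action T"
  shows "T i (T j x) = T (i + j) x"
  using assms unfolding N0_action_def by (metis comp_apply)

lemma continuous_on_birkhoff_average:
  assumes T: "N0_action T" and f: "continuous_on UNIV f"
  shows "continuous_on UNIV (birkhoff_average T f n)"
  unfolding birkhoff_average_def[abs_def] divide_inverse
  by (intro continuous_intros continuous_on_compose2[OF f]) (use T in \<open>auto simp: N0_action_def\<close>)

lemma integral_comp_invariant_probs:
  fixes f :: "'a::metric_space \<Rightarrow> real"
  assumes T: "N0_action T" and nu: "\<nu> \<in> invariant_probs T" and f: "continuous_on UNIV f"
  shows "(\<integral>x. f (T j x) \<partial>\<nu>) = integral\<^sup>L \<nu> f"
proof -
  have [measurable_cong]: "sets \<nu> = sets borel" and inv: "distr \<nu> borel (T j) = \<nu>"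
    using nu by (auto simp: invariant_probs_def borel_probs_def)
  have [measurable]: "T j \<in> borel_measurable borel" "f \<in> borel_measurable borel"
    using T f by (auto simp: N0_action_def intro: borel_measurable_continuous_onI)
  have "integral\<^sup>L \<nu> f = integral\<^sup>L (distr \<nu> borel (T j)) f" by (simp add: inv)
  also have "\<dots> = (\<integral>x. f (T j x) \<partial>\<nu>)" by (rule integral_distr) measurable
  finally show ?thesis ..
qed

lemma integral_birkhoff_average:
  fixes f :: "'a::metric_space \<Rightarrow> real"
  assumes comp: "compact (UNIV :: 'a set)" and T: "N0_action T" and nu: "\<nu> \<in> invariant_probs T"
    and f: "continuous_on UNIV f" and n: "1 \<le> n"
  shows "integral\<^sup>L \<nu> (birkhoff_average T f n) = integral\<^sup>L \<nu> f"
proof -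
  have "continuous_on UNIV (\<lambda>x. f (T j x))" for j
    by (rule continuous_on_compose2[OF f]) (use T in \<open>auto simp: N0_action_def\<close>)
  then have "integrable \<nu> (\<lambda>x. f (T j x))" for j
    using integrable_continuous_borel_probs[OF comp] nu by (auto simp: invariant_probs_def)
  then show ?thesis
    using n by (simp add: birkhoff_average_def[abs_def] integral_comp_invariant_probs[OF T nu f])
qed

text \<open>Moving a time window of length \<open>n\<close> by \<open>j\<close> steps loses
  \<open>j\<close> terms and gains \<open>j\<close> others. Both sums are completed to the sum over
  \<open>{..<n + j}\<close>, so only these \<open>2 * j\<close> terms count.\<close>

lemma birkhoff_average_shift_diff_le:
  assumes T: "N0_action T" and C: "\<And>x. \<bar>f x\<bar> \<le> C"
  shows "\<bar>birkhoff_average T (\<lambda>x. f (T j x)) n x - birkhoff_average T f n x\<bar> \<le> 2 * real j * C / real n"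
proof -
  have bd: "\<bar>\<Sum>i\<in>S. f (T i x)\<bar> \<le> real (card S) * C" for S
    by (rule order_trans[OF sum_abs sum_bounded_above]) (rule C)
  have "(\<Sum>i<n. f (T j (T i x))) = (\<Sum>i<n. f (T (i + j) x))"
    by (simp add: N0_action_add[OF T] add.commute)
  also have "\<dots> = (\<Sum>i\<in>{j..<n + j}. f (T i x))"
    by (simp add: sum.shift_bounds_nat_ivl[of _ 0 j n, simplified] lessThan_atLeast0)
  finally have 1: "(\<Sum>i<n. f (T j (T i x))) + (\<Sum>i<j. f (T i x)) = (\<Sum>i<n + j. f (T i x))"
    by (simp add: lessThan_atLeast0 add.commute sum.atLeastLessThan_concat)
  have 2: "(\<Sum>i<n. f (T i x)) + (\<Sum>i\<in>{n..<n + j}. f (T i x)) = (\<Sum>i<n + j. f (T i x))"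
    by (simp add: lessThan_atLeast0 sum.atLeastLessThan_concat)
  have "\<bar>(\<Sum>i<n. f (T j (T i x))) - (\<Sum>i<n. f (T i x))\<bar> \<le> 2 * real j * C"
    using 1 2 bd[of "{..<j}"] bd[of "{n..<n + j}"] by simp
  then show ?thesis
    by (simp add: birkhoff_average_def divide_right_mono flip: diff_divide_distrib)
qed

text \<open>The averages of \<open>f\<close> and of \<open>f\<close> composed with
  \<open>T j\<close> have the same limit, because their difference is of order
  \<open>j / \<pi> (r i)\<close>. Hence \<open>l\<close> and its image under \<open>T j\<close> give
  every continuous function the same integral, and so coincide.\<close>

lemma LS_empirical_measure_subset_invariant_probs:
  fixes T :: "nat \<Rightarrow> 'a::metric_space \<Rightarrow> 'a"
  assumes comp: "compact (UNIV :: 'a set)" and T: "N0_action T"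
    and pos: "\<And>k. 1 \<le> k \<Longrightarrow> 1 \<le> \<pi> k" and lim: "filterlim \<pi> at_top sequentially"
  shows "LS weak_star (\<lambda>k. empirical_measure T x (\<pi> k)) \<subseteq> invariant_probs T"
proof
  fix l assume "l \<in> LS weak_star (\<lambda>k. empirical_measure T x (\<pi> k))"
  then obtain r where r: "strict_mono r" "\<And>i. 1 \<le> r i" and l: "l \<in> borel_probs"
    and conv: "\<And>f :: 'a \<Rightarrow> real. continuous_on UNIV f \<Longrightarrow>
      (\<lambda>i. integral\<^sup>L (empirical_measure T x (\<pi> (r i))) f) \<longlonglongrightarrow> integral\<^sup>L l f"
    by (auto simp: LS_def limitin_weak_star)
  have conv': "(\<lambda>i. birkhoff_average T f (\<pi> (r i)) x) \<longlonglongrightarrow> integral\<^sup>L l f"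
    if "continuous_on UNIV f" for f :: "'a \<Rightarrow> real"
    using conv[OF that] r pos that
    by (simp add: integral_empirical_measure borel_measurable_continuous_onI)
  have "distr l borel (T j) = l" for j
  proof (rule borel_probs_eqI)
    interpret prob_space l using l by (simp add: borel_probs_def)
    have [measurable_cong]: "sets l = sets borel" using l by (simp add: borel_probs_def)
    have cT: "continuous_on UNIV (T j)" using T by (simp add: N0_action_def)
    then have [measurable]: "T j \<in> borel_measurable borel"
      by (rule borel_measurable_continuous_onI)
    show "distr l borel (T j) \<in> borel_probs"
      by (auto simp: borel_probs_def intro!: prob_space_distr)
    show "l \<in> borel_probs" by fact
    fix f :: "'a \<Rightarrow> real" assume f: "continuous_on UNIV f"
    have [measurable]: "f \<in> borel_measurable borel" using f by (rule borel_measurable_continuous_onI)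
    have fT: "continuous_on UNIV (\<lambda>x. f (T j x))"
      using continuous_on_compose2[OF f cT] by auto
    obtain C where C: "\<And>x. \<bar>f x\<bar> \<le> C" using bounded_continuous_real[OF comp f] by blast
    \<comment> \<open>The sampled lengths still tend to infinity along the subsequence, which makes
      the shift error vanish.\<close>
    have "filterlim (\<lambda>i. real (\<pi> (r i))) at_top sequentially"
      by (intro filterlim_compose[OF filterlim_real_sequentially] filterlim_compose[OF lim]
          filterlim_subseq r)
    then have "(\<lambda>i. 2 * real j * C / real (\<pi> (r i))) \<longlonglongrightarrow> 0"
      by (intro tendsto_divide_0[OF tendsto_const] filterlim_at_top_imp_at_infinity)
    then have "(\<lambda>i. birkhoff_average T (\<lambda>x. f (T j x)) (\<pi> (r i)) x - birkhoff_average T f (\<pi> (r i)) x) \<longlonglongrightarrow> 0"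
      by (rule Lim_null_comparison[rotated])
        (intro always_eventually allI,
          simp only: real_norm_def birkhoff_average_shift_diff_le[OF T, where f = f and C = C, OF C])
    moreover have "(\<lambda>i. birkhoff_average T (\<lambda>x. f (T j x)) (\<pi> (r i)) x - birkhoff_average T f (\<pi> (r i)) x)
        \<longlonglongrightarrow> (\<integral>x. f (T j x) \<partial>l) - integral\<^sup>L l f"
      by (intro tendsto_diff conv' f fT)
    ultimately have "(\<integral>x. f (T j x) \<partial>l) = integral\<^sup>L l f"
      using LIMSEQ_unique by fastforce
    then show "integral\<^sup>L (distr l borel (T j)) f = integral\<^sup>L l f"
      by (simp add: integral_distr)
  qed
  then show "l \<in> invariant_probs T" using l by (simp add: invariant_probs_def)
qed

section \<open>Sample points from a variance estimate\<close>

lemma exists_le_expectation: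
  fixes h :: "'a \<Rightarrow> real"
  assumes "prob_space M" "integrable M h" "integral\<^sup>L M h \<le> c"
  shows "\<exists>x\<in>space M. h x \<le> c"
proof (rule ccontr)
  assume "\<not> ?thesis"
  then have "AE x in M. c < h x" by (auto simp: not_le)
  then have "c < integral\<^sup>L M h"
    using prob_space.expectation_greater[OF assms(1,2)] by blast
  with assms(3) show False by simp
qed

text \<open>The sample points are chosen one at a time: averaged over the next point, the cross terms
  vanish, so some choice increases the sum of squares by at most \<open>n * B\<^sup>2\<close>.\<close>

lemma exists_sample_sum_squares_le:
  fixes g :: "nat \<Rightarrow> 'a \<Rightarrow> real"
  assumes M: "prob_space M"
    and meas: "\<And>i. g i \<in> borel_measurable M"
    and bd: "\<And>i x. i < n \<Longrightarrow> x \<in> space M \<Longrightarrow> \<bar>g i x\<bar> \<le> B"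
    and mean: "\<And>i. i < n \<Longrightarrow> integral\<^sup>L M (g i) = 0"
  shows "\<exists>xs. (\<Sum>i<n. (\<Sum>s<m. g i (xs s))\<^sup>2) \<le> real m * real n * B\<^sup>2"
proof (induction m)
  case 0
  show ?case by simp
next
  case (Suc m)
  interpret prob_space M by (rule M)
  obtain xs where xs: "(\<Sum>i<n. (\<Sum>s<m. g i (xs s))\<^sup>2) \<le> real m * real n * B\<^sup>2"
    using Suc by blast
  define S where "S i = (\<Sum>s<m. g i (xs s))" for i
  have int [simp]: "integrable M (g i)" if "i < n" for i
    using bd[OF that] meas by (intro integrable_const_bound[where B = B]) auto
  have sq_le: "(g i x)\<^sup>2 \<le> B\<^sup>2" if "i < n" "x \<in> space M" for i x
    using bd[OF that] by (simp add: abs_le_square_iff[symmetric])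
  have int2 [simp]: "integrable M (\<lambda>x. (g i x)\<^sup>2)" if "i < n" for i
    using sq_le[OF that] meas by (intro integrable_const_bound[where B = "B\<^sup>2"]) auto
  have eq: "(S i + g i x)\<^sup>2 = (S i)\<^sup>2 + 2 * S i * g i x + (g i x)\<^sup>2" for i x
    by (simp add: power2_sum)
  have step: "integrable M (\<lambda>x. (S i + g i x)\<^sup>2)"
    "expectation (\<lambda>x. (S i + g i x)\<^sup>2) \<le> (S i)\<^sup>2 + B\<^sup>2" if "i < n" for i
  proof -
    show "integrable M (\<lambda>x. (S i + g i x)\<^sup>2)" using that by (simp add: eq)
    have "expectation (\<lambda>x. (g i x)\<^sup>2) \<le> expectation (\<lambda>x. B\<^sup>2)"
      using that sq_le by (intro integral_mono) auto
    then show "expectation (\<lambda>x. (S i + g i x)\<^sup>2) \<le> (S i)\<^sup>2 + B\<^sup>2"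
      using that by (simp add: eq mean prob_space)
  qed
  have "integrable M (\<lambda>x. \<Sum>i<n. (S i + g i x)\<^sup>2)"
    using step(1) by (intro Bochner_Integration.integrable_sum) auto
  moreover have "expectation (\<lambda>x. \<Sum>i<n. (S i + g i x)\<^sup>2) \<le> (\<Sum>i<n. (S i)\<^sup>2 + B\<^sup>2)"
    using step by (subst Bochner_Integration.integral_sum) (auto intro!: sum_mono)
  ultimately obtain x where x: "(\<Sum>i<n. (S i + g i x)\<^sup>2) \<le> (\<Sum>i<n. (S i)\<^sup>2 + B\<^sup>2)"
    by (blast dest: exists_le_expectation[OF M])
  have "(\<Sum>i<n. (\<Sum>s<Suc m. g i ((xs(m := x)) s))\<^sup>2) = (\<Sum>i<n. (S i + g i x)\<^sup>2)"
    by (simp add: S_def)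
  also have "\<dots> \<le> real m * real n * B\<^sup>2 + real n * B\<^sup>2"
    using x xs by (simp add: sum.distrib S_def)
  also have "\<dots> = real (Suc m) * real n * B\<^sup>2" by (simp add: algebra_simps)
  finally show ?case by blast
qed

section \<open>Orbits cut into traced blocks and gaps\<close>

text \<open>The disjoint blocks \<open>{c s..<c s + L}\<close> take up \<open>m * L\<close> of the
  \<open>c m\<close> times, and each remaining time contributes at most \<open>C\<close>. The base
  case accounts for the times before the first block, each induction step for one block and the gap
  behind it.\<close>

lemma sum_blocks_diff_le:
  fixes g :: "nat \<Rightarrow> real"
  assumes C: "\<And>t. \<bar>g t\<bar> \<le> C" and c: "\<And>s. s < m \<Longrightarrow> c s + L \<le> c (Suc s)"
  shows "\<bar>(\<Sum>t<c m. g t) - (\<Sum>s<m. \<Sum>i<L. g (c s + i))\<bar> \<le> C * (real (c m) - real m * real L)"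
  using c
proof (induction m)
  case 0
  have "\<bar>\<Sum>t<c 0. g t\<bar> \<le> real (card {..<c 0}) * C"
    by (rule order_trans[OF sum_abs sum_bounded_above]) (rule C)
  then show ?case by (simp add: mult.commute)
next
  case (Suc m)
  have le: "c m + L \<le> c (Suc m)" using Suc.prems by simp
  have "(\<Sum>t<c (Suc m). g t) = (\<Sum>t<c m. g t) + (\<Sum>t=c m..<c m + L. g t) + (\<Sum>t=c m + L..<c (Suc m). g t)"
    using le by (simp add: lessThan_atLeast0 sum.atLeastLessThan_concat)
  moreover have "(\<Sum>t=c m..<c m + L. g t) = (\<Sum>i<L. g (c m + i))"
    using sum.shift_bounds_nat_ivl[of g 0 "c m" L] by (simp add: lessThan_atLeast0 add.commute)
  moreover have "\<bar>\<Sum>t=c m + L..<c (Suc m). g t\<bar> \<le> (real (c (Suc m)) - real (c m) - real L) * C"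
  proof -
    have "\<bar>\<Sum>t=c m + L..<c (Suc m). g t\<bar> \<le> real (card {c m + L..<c (Suc m)}) * C"
      by (rule order_trans[OF sum_abs sum_bounded_above]) (rule C)
    also have "real (card {c m + L..<c (Suc m)}) = real (c (Suc m)) - real (c m) - real L"
      using le by (simp add: of_nat_diff)
    finally show ?thesis .
  qed
  moreover have "\<bar>(\<Sum>t<c m. g t) - (\<Sum>s<m. \<Sum>i<L. g (c s + i))\<bar> \<le> C * (real (c m) - real m * real L)"
    using Suc by simp
  ultimately have "\<bar>(\<Sum>t<c (Suc m). g t) - (\<Sum>s<Suc m. \<Sum>i<L. g (c s + i))\<bar>
      \<le> C * (real (c m) - real m * real L) + (real (c (Suc m)) - real (c m) - real L) * C"
    unfolding sum.lessThan_Suc by linarith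
  also have "\<dots> = C * (real (c (Suc m)) - real (Suc m) * real L)"
    by (simp add: algebra_simps)
  finally show ?case .
qed

text \<open>Specifications live on positive times, so \<open>u\<close> is traced at time 1 and \<open>z\<close> is the image
  under \<open>T 1\<close> of a tracing point. The gaps do not depend on the length \<open>L\<close> of the blocks.\<close>

lemma very_weak_specification_tracing_blocks:
  fixes T :: "nat \<Rightarrow> 'a::metric_space \<Rightarrow> 'a"
  assumes T: "N0_action T" and V: "very_weak_specification T" and \<delta>: "0 < \<delta>" "\<delta> < 1"
  obtains gap :: "nat \<Rightarrow> nat"
  where "\<And>u xs m L. 1 \<le> L \<Longrightarrow> \<exists>z. dist u z < \<delta> \<and>
    (\<forall>s<m. \<forall>i<L. dist (T i (xs s)) (T ((\<Sum>t\<le>s. gap t) + s * L + i) z) < \<delta>)"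
proof -
  obtain M where M: "\<And>n a b x. specification_intervals n a b \<Longrightarrow> spaced (M \<delta>) n a b \<Longrightarrow>
      \<exists>y. tracing T \<delta> n a b x y"
  proof -
    from V obtain M where "\<forall>\<delta>\<in>{0<..<1}. \<forall>n a b x.
        specification_intervals n a b \<and> spaced (M \<delta>) n a b \<longrightarrow> (\<exists>y. tracing T \<delta> n a b x y)"
      unfolding very_weak_specification_def by blast
    with that[of M] \<delta> show ?thesis by simp
  qed
  \<comment> \<open>Block \<open>s\<close> is interval number \<open>s + 2\<close> of the
    specification: intervals are numbered from 1, and the first one is reserved for
    \<open>u\<close>.\<close>
  define gap where "gap t = M \<delta> (t + 2)" for t
  show ?thesis
  proof
    fix u and xs :: "nat \<Rightarrow> 'a" and m L :: nat
    assume L: "1 \<le> L"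
    \<comment> \<open>The leading 1 in \<open>a j\<close> is absorbed by passing from
      \<open>y\<close> to \<open>T 1 y\<close>. The interval for \<open>u\<close> is the single time
      1, and every later one holds exactly \<open>L\<close> times. The first gap is exactly the
      required one; the later ones exceed the requirement by 1, as \<open>b j\<close> is the last
      time of a block.\<close>
    define a where "a j = (if j \<le> 1 then 1 else 1 + ((\<Sum>t\<le>j - 2. gap t) + (j - 2) * L))" for j
    define b where "b j = (if j \<le> 1 then 1 else a j + L - 1)" for j
    define x where "x j = (if j \<le> 1 then u else xs (j - 2))" for j
    have "specification_intervals (Suc m) a b"
      using L by (auto simp: specification_intervals_def a_def b_def)
    moreover have "spaced (M \<delta>) (Suc m) a b"
      unfolding spaced_def
    proof
      fix j assume "j \<in> {2..Suc m}"
      then have "2 \<le> j" by simp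
      then obtain i where j: "j = i + 2" by (metis add.commute le_Suc_ex)
      show "int (M \<delta> j) \<le> int (a j) - int (b (j - 1))"
      proof (cases i)
        case 0
        then show ?thesis using j by (simp add: a_def b_def gap_def)
      next
        case (Suc i')
        then show ?thesis using j L by (simp add: a_def b_def gap_def of_nat_diff)
      qed
    qed
    ultimately obtain y where y: "tracing T \<delta> (Suc m) a b x y" using M by blast
    have "dist u (T 1 y) < \<delta>"
      using y[unfolded tracing_def, rule_format, of 1 0] T
      by (simp add: a_def b_def x_def N0_action_def)
    moreover have "dist (T i (xs s)) (T ((\<Sum>t\<le>s. gap t) + s * L + i) (T 1 y)) < \<delta>"
      if "s < m" "i < L" for s i
      using y[unfolded tracing_def, rule_format, of "s + 2" i] that
      by (simp add: a_def b_def x_def N0_action_add[OF T])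
    ultimately show "\<exists>z. dist u z < \<delta> \<and>
        (\<forall>s<m. \<forall>i<L. dist (T i (xs s)) (T ((\<Sum>t\<le>s. gap t) + s * L + i) z) < \<delta>)"
      by blast
  qed
qed

section \<open>Uniformity over finitely many functions, and Baire category\<close>

lemma uniformly_bounded_finite_family:
  fixes f :: "nat \<Rightarrow> 'a::topological_space \<Rightarrow> real"
  assumes "compact (UNIV :: 'a set)" "\<And>i. continuous_on UNIV (f i)"
  obtains C where "C > 0" "\<And>i x. i < n \<Longrightarrow> \<bar>f i x\<bar> \<le> C"
proof -
  have "\<exists>C>0. \<forall>i<n. \<forall>x. \<bar>f i x\<bar> \<le> C"
  proof (induction n)
    case 0
    show ?case by (auto intro: exI[of _ 1])
  next
    case (Suc n)
    then obtain C where C: "C > 0" "\<forall>i<n. \<forall>x. \<bar>f i x\<bar> \<le> C" by blast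
    obtain D where D: "D > 0" "\<And>x. \<bar>f n x\<bar> \<le> D"
      using bounded_continuous_real[OF assms] by blast
    show ?case
      using C D by (intro exI[of _ "max C D"]) (auto simp: less_Suc_eq le_max_iff_disj)
  qed
  then show ?thesis using that by blast
qed

lemma uniformly_equicontinuous_finite_family:
  fixes f :: "nat \<Rightarrow> 'a::metric_space \<Rightarrow> real"
  assumes "compact (UNIV :: 'a set)" "\<And>i. continuous_on UNIV (f i)" "e > 0"
  obtains d where "d > 0" "\<And>i x y. i < n \<Longrightarrow> dist x y < d \<Longrightarrow> \<bar>f i x - f i y\<bar> < e"
proof -
  have "\<exists>d>0. \<forall>i<n. \<forall>x y. dist x y < d \<longrightarrow> \<bar>f i x - f i y\<bar> < e"
  proof (induction n)
    case 0
    show ?case by (auto intro: exI[of _ 1])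
  next
    case (Suc n)
    then obtain d where d: "d > 0" "\<forall>i<n. \<forall>x y. dist x y < d \<longrightarrow> \<bar>f i x - f i y\<bar> < e" by blast
    obtain d' where d': "d' > 0" "\<And>x y. dist x y < d' \<Longrightarrow> \<bar>f n x - f n y\<bar> < e"
      using uniformly_continuous_onE[OF compact_uniformly_continuous[OF assms(2,1)] assms(3)]
      unfolding dist_real_def by (metis UNIV_I)
    show ?case
      using d d' by (intro exI[of _ "min d d'"]) (auto simp: less_Suc_eq)
  qed
  then show ?thesis using that by blast
qed

lemma gdelta_Inter_countable:
  assumes "countable \<U>" "\<And>U. U \<in> \<U> \<Longrightarrow> open U"
  shows "gdelta (\<Inter>\<U>)"
proof (cases "\<U> = {}")
  case True
  then show ?thesis using gdelta.intros[of "\<lambda>_. UNIV"] by simp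
next
  case False
  then have "range (from_nat_into \<U>) = \<U>" using assms(1) by (rule range_from_nat_into)
  then show ?thesis using gdelta.intros[of "from_nat_into \<U>"] assms(2) from_nat_into[OF False] by metis
qed

text \<open>A compact metric space is locally compact and regular, so Baire's theorem for such
  spaces applies.\<close>

lemma closure_Inter_open_dense_compact:
  fixes \<U> :: "'a::metric_space set set"
  assumes "compact (UNIV :: 'a set)" "countable \<U>"
    and "\<And>U. U \<in> \<U> \<Longrightarrow> open U \<and> closure U = UNIV"
  shows "closure (\<Inter>\<U>) = UNIV"
proof -
  have "compact_space (euclidean :: 'a topology)"
    using assms(1) by (simp add: compact_space_def)
  then have "locally_compact_space (euclidean :: 'a topology) \<and> regular_space (euclidean :: 'a topology)"
    by (simp add: compact_imp_locally_compact_space compact_Hausdorff_imp_regular_space)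
  then show ?thesis
    using Baire_category[of "euclidean :: 'a topology" \<U>] assms(2,3) by simp
qed


section \<open>Points near \<open>u\<close> whose long averages are close to a given invariant
  measure\<close>

text \<open>The constants are fixed in the order \<open>\<delta>\<close>, \<open>gap\<close>,
  \<open>m\<close>, \<open>G\<close>, \<open>K\<close>; only then come \<open>P\<close> and the
  block length \<open>L\<close>. Thus the time spent outside the blocks is bounded independently of
  \<open>P\<close>. All large \<open>P\<close> are covered because \<open>P\<close> will be a value
  of a sampling function, which is not free to choose.\<close>

lemma exists_near_point_birkhoff_average:
  fixes T :: "nat \<Rightarrow> 'a::metric_space \<Rightarrow> 'a" and f :: "nat \<Rightarrow> 'a \<Rightarrow> real"
  assumes comp: "compact (UNIV :: 'a set)" and T: "N0_action T" and V: "very_weak_specification T"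
    and nu: "\<nu> \<in> invariant_probs T" and f: "\<And>i. continuous_on UNIV (f i)"
    and e: "e > 0" and \<eta>: "\<eta> > 0"
  shows "\<exists>P0. \<forall>P\<ge>P0. \<exists>z. dist u z < \<eta> \<and>
    (\<forall>i<n. \<bar>birkhoff_average T (f i) P z - integral\<^sup>L \<nu> (f i)\<bar> < e)"
proof -
  have nu': "\<nu> \<in> borel_probs" and sets_nu: "sets \<nu> = sets borel"
    using nu by (auto simp: invariant_probs_def borel_probs_def)
  interpret nu: prob_space \<nu> using nu' by (simp add: borel_probs_def)
  obtain C where C: "C > 0" "\<And>i x. i < n \<Longrightarrow> \<bar>f i x\<bar> \<le> C"
    using uniformly_bounded_finite_family[of f n, OF comp f] by blast
  have nuC: "\<bar>integral\<^sup>L \<nu> (f i)\<bar> \<le> C" if "i < n" for i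
    using borel_probs_integral_diff_le[OF comp nu' f[of i], of "\<lambda>_. 0" C] C(2)[OF that] by simp
  have "e / 4 > 0" using e by simp
  then obtain d where d: "d > 0" "\<And>i x y. i < n \<Longrightarrow> dist x y < d \<Longrightarrow> \<bar>f i x - f i y\<bar> < e / 4"
    using uniformly_equicontinuous_finite_family[of f "e / 4" n, OF comp f] by blast
  \<comment> \<open>Tracing within \<open>d\<close> controls the test functions, tracing within
    \<open>\<eta>\<close> keeps \<open>z\<close> near \<open>u\<close>, and 1/2 keeps
    \<open>\<delta>\<close> in the range of the specification property.\<close>
  define \<delta> where "\<delta> = min (min d \<eta>) (1 / 2)"
  have \<delta>: "0 < \<delta>" "\<delta> < 1" "\<delta> \<le> d" "\<delta> \<le> \<eta>" using d(1) \<eta> by (auto simp: \<delta>_def)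
  obtain gap where gap: "\<And>u xs m L. 1 \<le> L \<Longrightarrow> \<exists>z. dist u z < \<delta> \<and>
    (\<forall>s<m. \<forall>i<L. dist (T i (xs s)) (T ((\<Sum>t\<le>s. gap t) + s * L + i) z) < \<delta>)"
    using very_weak_specification_tracing_blocks[OF T V \<delta>(1,2)] by blast
  \<comment> \<open>This bound is equivalent to
    \<open>m * n * (2 * C)\<^sup>2 < (m * e / 4)\<^sup>2\<close> for positive \<open>m\<close>,
    which turns the sum of squares into a mean error of at most \<open>e / 4\<close>.\<close>
  obtain m :: nat where m: "64 * real n * C\<^sup>2 / e\<^sup>2 < real m"
    using reals_Archimedean2 by blast
  have "0 \<le> 64 * real n * C\<^sup>2 / e\<^sup>2" by simp
  with m have m0: "0 < m" by linarith
  define G where "G = (\<Sum>t<m. gap t)"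
  \<comment> \<open>For \<open>P\<close> at least \<open>K\<close>, the two errors
    \<open>C * (G + m)\<close> caused by times outside the blocks add up to less than
    \<open>P * e / 2\<close>.\<close>
  obtain K :: nat where K: "4 * C * real (G + m) / e < real K"
    using reals_Archimedean2 by blast
  have "\<exists>z. dist u z < \<eta> \<and> (\<forall>i<n. \<bar>birkhoff_average T (f i) P z - integral\<^sup>L \<nu> (f i)\<bar> < e)"
    if P: "G + m + K \<le> P" for P
  proof -
    \<comment> \<open>The largest length for which \<open>m\<close> blocks and all gaps fit into
      \<open>P\<close> times; fewer than \<open>m\<close> times are left over at the end.\<close>
    define L where "L = (P - G) div m"
    have L: "1 \<le> L" using P m0 by (simp add: L_def div_greater_zero_iff Suc_le_eq)
    have mL: "G + m * L \<le> P"
      using P times_div_less_eq_dividend[of m "P - G"] unfolding L_def by linarith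
    have "P - G < m * L + m"
      using m0 by (metis L_def dividend_less_div_times mult.commute add.commute)
    then have PmL: "real P - real m * real L \<le> real (G + m)"
      by (simp flip: of_nat_mult of_nat_add)
    have P0: "0 < real P" using P m0 by simp
    \<comment> \<open>Centred block averages: invariance of \<open>\<nu>\<close> gives them mean 0,
      and they are bounded by \<open>2 * C\<close>.\<close>
    define g where "g i x = birkhoff_average T (f i) L x - integral\<^sup>L \<nu> (f i)" for i x
    have "\<exists>xs. (\<Sum>i<n. (\<Sum>s<m. g i (xs s))\<^sup>2) \<le> real m * real n * (2 * C)\<^sup>2"
    proof (rule exists_sample_sum_squares_le[OF nu.prob_space_axioms])
      have cont: "continuous_on UNIV (birkhoff_average T (f i) L)" for i
        by (rule continuous_on_birkhoff_average[OF T f])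
      have cg: "continuous_on UNIV (g i)" for i
        unfolding g_def by (intro continuous_intros cont)
      then show "g i \<in> borel_measurable \<nu>" for i
        by (simp add: borel_measurable_continuous_onI cong: measurable_cong_sets[OF sets_nu refl])
      fix i assume i: "i < n"
      have avg_le: "\<bar>birkhoff_average T (f i) L x\<bar> \<le> C" for x
      proof -
        have "\<bar>\<Sum>j<L. f i (T j x)\<bar> \<le> real (card {..<L}) * C"
          by (rule order_trans[OF sum_abs sum_bounded_above]) (rule C(2)[OF i])
        then show ?thesis using L by (simp add: birkhoff_average_def field_simps)
      qed
      show "\<bar>g i x\<bar> \<le> 2 * C" for x
        using avg_le[of x] nuC[OF i] unfolding g_def by linarith
      show "nu.expectation (g i) = 0"
        using integrable_continuous_borel_probs[OF comp cont nu', of i]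
          integral_birkhoff_average[OF comp T nu f L, of i]
        unfolding g_def[abs_def] by (simp add: nu.prob_space)
    qed
    then obtain xs where xs: "(\<Sum>i<n. (\<Sum>s<m. g i (xs s))\<^sup>2) \<le> real m * real n * (2 * C)\<^sup>2"
      by blast
    have avg: "\<bar>\<Sum>s<m. g i (xs s)\<bar> \<le> real m * e / 4" if i: "i < n" for i
    proof -
      have "(\<Sum>s<m. g i (xs s))\<^sup>2 \<le> (\<Sum>i<n. (\<Sum>s<m. g i (xs s))\<^sup>2)"
        using i by (intro member_le_sum) auto
      also have "\<dots> \<le> real m * (4 * real n * C\<^sup>2)"
        using xs by (simp add: power_mult_distrib mult_ac)
      also have "\<dots> \<le> real m * (real m * e\<^sup>2 / 16)"
        using m e by (intro mult_left_mono) (simp_all add: field_simps)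
      also have "\<dots> = (real m * e / 4)\<^sup>2" by (simp add: power2_eq_square)
      finally have "\<bar>\<Sum>s<m. g i (xs s)\<bar> \<le> \<bar>real m * e / 4\<bar>"
        by (simp only: abs_le_square_iff)
      then show ?thesis using e by simp
    qed
    \<comment> \<open>Block \<open>s\<close> starts at \<open>c s\<close>; the value
      \<open>P\<close> at \<open>s = m\<close> closes the last gap, so that blocks and gaps fill
      exactly \<open>{..<P}\<close>.\<close>
    define c where "c s = (if s < m then (\<Sum>t\<le>s. gap t) + s * L else P)" for s
    have c_step: "c s + L \<le> c (Suc s)" if "s < m" for s
    proof (cases "Suc s < m")
      case True
      then show ?thesis by (simp add: c_def)
    next
      case False
      then have "m = Suc s" using that by simp
      then show ?thesis using mL by (simp add: c_def G_def lessThan_Suc_atMost)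
    qed
    obtain z where z: "dist u z < \<delta>" "\<And>s i. s < m \<Longrightarrow> i < L \<Longrightarrow> dist (T i (xs s)) (T (c s + i) z) < \<delta>"
      using gap[OF L, of u m xs] by (auto simp: c_def)
    have "\<bar>birkhoff_average T (f i) P z - integral\<^sup>L \<nu> (f i)\<bar> < e" if i: "i < n" for i
    proof -
      let ?v = "integral\<^sup>L \<nu> (f i)"
      let ?S = "\<Sum>t<P. f i (T t z)"
      let ?B = "\<Sum>s<m. \<Sum>j<L. f i (T (c s + j) z)"
      let ?X = "\<Sum>s<m. \<Sum>j<L. f i (T j (xs s))"
      let ?D = "real P - real m * real L"
      \<comment> \<open>Four comparisons lead from the orbit sum to \<open>P * ?v\<close>: dropping
        the gaps, replacing the orbit of \<open>z\<close> by the traced segments, the sampling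
        error, and restoring the weight of the gaps.\<close>
      have "\<bar>?S - ?B\<bar> \<le> C * ?D"
        using sum_blocks_diff_le[of "\<lambda>t. f i (T t z)" C m c L, OF C(2)[OF i] c_step]
        by (simp add: c_def)
      moreover have "\<bar>?B - ?X\<bar> \<le> real m * real L * (e / 4)"
      proof -
        have "\<bar>f i (T (c s + j) z) - f i (T j (xs s))\<bar> \<le> e / 4" if "s < m" "j < L" for s j
          using z(2)[OF that] \<delta>(3) d(2)[OF i, of "T j (xs s)" "T (c s + j) z"] by linarith
        then have block: "\<bar>(\<Sum>j<L. f i (T (c s + j) z) - f i (T j (xs s)))\<bar> \<le> real (card {..<L}) * (e / 4)"
          if "s < m" for s
          by (rule order_trans[OF sum_abs sum_bounded_above]) (use that in auto)
        have "\<bar>(\<Sum>s<m. \<Sum>j<L. f i (T (c s + j) z) - f i (T j (xs s)))\<bar>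
            \<le> real (card {..<m}) * (real (card {..<L}) * (e / 4))"
          by (rule order_trans[OF sum_abs sum_bounded_above]) (use block in blast)
        then show ?thesis by (simp add: sum_subtractf)
      qed
      moreover have "\<bar>?X - real m * real L * ?v\<bar> \<le> real m * real L * (e / 4)"
      proof -
        have "(\<Sum>j<L. f i (T j x)) = real L * g i x + real L * ?v" for x
          using L by (simp add: g_def birkhoff_average_def algebra_simps)
        then have "?X - real m * real L * ?v = real L * (\<Sum>s<m. g i (xs s))"
          by (simp add: sum.distrib sum_distrib_left)
        also have "\<bar>\<dots>\<bar> \<le> real L * (real m * e / 4)"
          using mult_left_mono[OF avg[OF i], of "real L"] by (simp only: abs_mult abs_of_nat of_nat_0_le_iff)
        finally show ?thesis by (simp add: mult_ac)
      qed
      moreover have "\<bar>real m * real L * ?v - real P * ?v\<bar> \<le> C * ?D"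
      proof -
        have "0 \<le> ?D" using mL by (simp flip: of_nat_mult)
        then have "\<bar>?v * ?D\<bar> \<le> C * ?D" using nuC[OF i] by (simp add: abs_mult mult_right_mono)
        then show ?thesis by (simp add: algebra_simps abs_minus_commute)
      qed
      ultimately have "\<bar>?S - real P * ?v\<bar> \<le> 2 * (C * ?D) + real m * real L * (e / 2)"
        by linarith
      also have "\<dots> \<le> 2 * (C * real (G + m)) + real P * (e / 2)"
      proof (intro add_mono mult_left_mono mult_right_mono PmL)
        have "m * L \<le> P" using mL by simp
        then show "real m * real L \<le> real P" by (simp flip: of_nat_mult)
      qed (use C e in auto)
      also have "\<dots> < real P * e"
      proof -
        have "4 * C * real (G + m) < real K * e" using K e by (simp add: field_simps)
        also have "\<dots> \<le> real P * e" using P e by (intro mult_right_mono) auto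
        finally show ?thesis by simp
      qed
      finally have "\<bar>?S - real P * ?v\<bar> < real P * e" .
      moreover have "birkhoff_average T (f i) P z - ?v = (?S - real P * ?v) / real P"
        using P0 by (simp add: birkhoff_average_def field_simps)
      ultimately show ?thesis using P0 by (simp add: abs_divide pos_divide_less_eq mult.commute)
    qed
    then show ?thesis using z(1) \<delta>(4) by (intro exI[of _ z]) auto
  qed
  then show ?thesis by blast
qed


section \<open>From approximation along an orbit to a residual set\<close>

text \<open>Indices are chosen one after another, the \<open>n\<close>-th controlling the first
  \<open>n\<close> test functions with tolerance \<open>2 / Suc n\<close>. Each fixed test function
  is controlled from some stage on, which yields convergence on the whole countable family and then
  on all continuous functions.\<close>

lemma mem_LS_empirical_measureI:
  fixes T :: "nat \<Rightarrow> 'a::metric_space \<Rightarrow> 'a" and \<phi> :: "nat \<Rightarrow> 'a \<Rightarrow> real"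
  assumes comp: "compact (UNIV :: 'a set)"
    and \<phi>: "\<And>i. continuous_on UNIV (\<phi> i)"
    and dense: "\<And>(f :: 'a \<Rightarrow> real) e. continuous_on UNIV f \<Longrightarrow> e > 0 \<Longrightarrow>
      \<exists>(I :: 'a set) c idx. finite I \<and> (\<forall>x. \<bar>f x - (\<Sum>p\<in>I. c p * \<phi> (idx p) x)\<bar> \<le> e)"
    and pos: "\<And>k. 1 \<le> k \<Longrightarrow> 1 \<le> \<pi> k"
    and nu: "\<nu> \<in> borel_probs"
    and approx: "\<And>n N. \<exists>k\<ge>N. \<forall>i<n. \<bar>birkhoff_average T (\<phi> i) (\<pi> k) x - integral\<^sup>L \<nu> (\<phi> i)\<bar> < 2 / Suc n"
  shows "\<nu> \<in> LS weak_star (\<lambda>k. empirical_measure T x (\<pi> k))"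
proof -
  have "\<exists>r. \<forall>n. (1 \<le> r n \<and> (\<forall>i<n. \<bar>birkhoff_average T (\<phi> i) (\<pi> (r n)) x - integral\<^sup>L \<nu> (\<phi> i)\<bar> < 2 / Suc n))
      \<and> r n < r (Suc n)"
  proof (rule dependent_nat_choice, goal_cases)
    case 1
    \<comment> \<open>At stage 0 no test function is controlled; the index only has to be at least
      1, as \<open>LS\<close> demands.\<close>
    show ?case using approx[of 1 0] by blast
  next
    case (2 k n)
    obtain k' where "Suc k \<le> k'" "\<forall>i<Suc n. \<bar>birkhoff_average T (\<phi> i) (\<pi> k') x - integral\<^sup>L \<nu> (\<phi> i)\<bar> < 2 / Suc (Suc n)"
      using approx[of "Suc k" "Suc n"] by blast
    then show ?case by (intro exI[of _ k']) simp
  qed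
  then obtain r where r: "\<And>n. 1 \<le> r n" "strict_mono r"
    and close: "\<And>n i. i < n \<Longrightarrow> \<bar>birkhoff_average T (\<phi> i) (\<pi> (r n)) x - integral\<^sup>L \<nu> (\<phi> i)\<bar> < 2 / Suc n"
    by (auto simp: strict_mono_Suc_iff)
  let ?z = "\<lambda>n. empirical_measure T x (\<pi> (r n))"
  have z: "?z n \<in> borel_probs" for n
    using r(1) pos empirical_measure_in_borel_probs by blast
  have "(\<lambda>n. integral\<^sup>L (?z n) (\<phi> i)) \<longlonglongrightarrow> integral\<^sup>L \<nu> (\<phi> i)" for i
  proof -
    have "(\<lambda>n. 2 / real (Suc n)) \<longlonglongrightarrow> 0"
      using LIMSEQ_Suc[OF lim_const_over_n[of "2 :: real"]] by simp
    moreover have "\<forall>\<^sub>F n in sequentially.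
        norm (birkhoff_average T (\<phi> i) (\<pi> (r n)) x - integral\<^sup>L \<nu> (\<phi> i)) \<le> 2 / real (Suc n)"
      using eventually_gt_at_top[of i] by eventually_elim (use close less_imp_le in auto)
    ultimately have "(\<lambda>n. birkhoff_average T (\<phi> i) (\<pi> (r n)) x - integral\<^sup>L \<nu> (\<phi> i)) \<longlonglongrightarrow> 0"
      by (rule Lim_null_comparison[rotated])
    then have "(\<lambda>n. birkhoff_average T (\<phi> i) (\<pi> (r n)) x) \<longlonglongrightarrow> integral\<^sup>L \<nu> (\<phi> i)"
      by (rule LIM_zero_cancel)
    then show ?thesis
      using r(1) pos by (simp add: integral_empirical_measure borel_measurable_continuous_onI \<phi>)
  qed
  note lim_\<phi> = this
  have "(\<lambda>n. integral\<^sup>L (?z n) f) \<longlonglongrightarrow> integral\<^sup>L \<nu> f" if "continuous_on UNIV f" for f :: "'a \<Rightarrow> real"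
    by (rule integral_tendsto_if_test_functions[OF comp \<phi> dense z nu lim_\<phi> that])
  then have "limitin weak_star ?z \<nu> sequentially"
    by (simp add: limitin_weak_star nu z)
  then show ?thesis using r by (auto simp: LS_def)
qed

theorem theorem6p6:
  fixes T :: "nat \<Rightarrow> 'a::metric_space \<Rightarrow> 'a"
    and \<P> :: "(nat \<Rightarrow> nat) set"
  assumes "compact (UNIV :: 'a set)"
    and "N0_action T"
    and "sampling_family \<P>" and "countable \<P>"
    and "very_weak_specification T"
  shows "residual (sampled_generic_points T \<P>)"
proof -
  note comp = assms(1) and T = assms(2)
  have pos: "\<And>k. 1 \<le> k \<Longrightarrow> 1 \<le> \<pi> k" and lim: "filterlim \<pi> at_top sequentially" if "\<pi> \<in> \<P>" for \<pi>
    using assms(3) that by (auto simp: sampling_family_def)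
  obtain \<phi> :: "nat \<Rightarrow> 'a \<Rightarrow> real" where \<phi>: "\<And>i. continuous_on UNIV (\<phi> i)"
    and dense: "\<And>(f :: 'a \<Rightarrow> real) e. continuous_on UNIV f \<Longrightarrow> e > 0 \<Longrightarrow>
      \<exists>(I :: 'a set) c idx. finite I \<and> (\<forall>x. \<bar>f x - (\<Sum>p\<in>I. c p * \<phi> (idx p) x)\<bar> \<le> e)"
    using countable_test_functions[OF comp] by blast
  define close where "close q \<nu> \<longleftrightarrow>
    (\<forall>i<length q. \<bar>integral\<^sup>L \<nu> (\<phi> i) - of_rat (q ! i)\<bar> < 1 / Suc (length q))" for q \<nu>
  define Q where "Q = {q. \<exists>\<nu>\<in>invariant_probs T. close q \<nu>}"
  define U where "U = (\<lambda>(\<pi>, N :: nat, q). \<Union>k\<in>{N..}. {x.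
    \<forall>i<length q. \<bar>birkhoff_average T (\<phi> i) (\<pi> k) x - of_rat (q ! i)\<bar> < 1 / Suc (length q)})"
  define \<U> where "\<U> = U ` (\<P> \<times> UNIV \<times> Q)"
  have countable: "countable \<U>"
    unfolding \<U>_def using assms(4) by (intro countable_image countable_SIGMA) auto
  note cont = continuous_on_birkhoff_average[OF T \<phi>]
  have open_U: "open (U p)" for p
  proof -
    have "open (\<Inter>i\<in>{..<length q}. {x.
        \<bar>birkhoff_average T (\<phi> i) n x - of_rat (q ! i)\<bar> < 1 / Suc (length q)})"
      for n and q :: "rat list"
      by (intro open_INT finite_lessThan ballI open_Collect_less continuous_intros cont)
    also have "(\<Inter>i\<in>{..<length q}. {x.
        \<bar>birkhoff_average T (\<phi> i) n x - of_rat (q ! i)\<bar> < 1 / Suc (length q)}) =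
      {x. \<forall>i<length q. \<bar>birkhoff_average T (\<phi> i) n x - of_rat (q ! i)\<bar> < 1 / Suc (length q)}"
      for n and q :: "rat list"
      by auto
    finally show ?thesis by (cases p) (auto simp only: U_def prod.case intro!: open_UN)
  qed
  have dense_U: "closure (U (\<pi>, N, q)) = UNIV" if \<pi>: "\<pi> \<in> \<P>" and q: "q \<in> Q" for \<pi> N q
  proof -
    obtain \<nu> where nu: "\<nu> \<in> invariant_probs T" and "close q \<nu>"
      using q by (auto simp: Q_def)
    let ?d = "\<lambda>i. \<bar>integral\<^sup>L \<nu> (\<phi> i) - of_rat (q ! i)\<bar>"
    \<comment> \<open>The slack left by the strict inequalities in \<open>close\<close>; inserting 0
      keeps the maximum defined for the empty list.\<close>
    define e where "e = 1 / Suc (length q) - Max (insert 0 (?d ` {..<length q}))"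
    have e: "e > 0" using \<open>close q \<nu>\<close> by (auto simp: e_def close_def)
    have d_le: "?d i \<le> 1 / Suc (length q) - e" if "i < length q" for i
      using that by (auto simp: e_def)
    have "u \<in> closure (U (\<pi>, N, q))" for u
      unfolding closure_approachable
    proof (intro allI impI)
      fix \<eta> :: real assume "\<eta> > 0"
      then obtain P0 where P0: "\<And>P. P0 \<le> P \<Longrightarrow> \<exists>z. dist u z < \<eta> \<and>
          (\<forall>i<length q. \<bar>birkhoff_average T (\<phi> i) P z - integral\<^sup>L \<nu> (\<phi> i)\<bar> < e)"
        using exists_near_point_birkhoff_average[where f = \<phi>, OF comp T assms(5) nu \<phi> e] by blast
      \<comment> \<open>As \<open>\<pi>\<close> tends to infinity, a single \<open>k\<close> can be
        both beyond \<open>N\<close> and give a length beyond \<open>P0\<close>.\<close>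
      obtain k where k: "N \<le> k" "P0 \<le> \<pi> k"
        using lim[OF \<pi>] unfolding filterlim_at_top eventually_sequentially by (meson nle_le)
      obtain z where z: "dist u z < \<eta>"
        "\<And>i. i < length q \<Longrightarrow> \<bar>birkhoff_average T (\<phi> i) (\<pi> k) z - integral\<^sup>L \<nu> (\<phi> i)\<bar> < e"
        using P0[OF k(2)] by blast
      have "\<bar>birkhoff_average T (\<phi> i) (\<pi> k) z - of_rat (q ! i)\<bar> < 1 / Suc (length q)"
        if "i < length q" for i
        using z(2)[OF that] d_le[OF that] by linarith
      then have "z \<in> U (\<pi>, N, q)" using k(1) by (auto simp: U_def)
      then show "\<exists>y\<in>U (\<pi>, N, q). dist y u < \<eta>" using z(1) by (auto simp: dist_commute)
    qed
    then show ?thesis by blast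
  qed
  have "x \<in> sampled_generic_points T \<P>" if x: "x \<in> \<Inter>\<U>" for x
    unfolding sampled_generic_points_def
  proof (intro CollectI ballI equalityI subsetI)
    fix \<pi> \<nu> assume \<pi>: "\<pi> \<in> \<P>" and "\<nu> \<in> LS weak_star (\<lambda>k. empirical_measure T x (\<pi> k))"
    then show "\<nu> \<in> invariant_probs T"
      using LS_empirical_measure_subset_invariant_probs[OF comp T pos[OF \<pi>] lim[OF \<pi>]] by blast
  next
    fix \<pi> \<nu> assume \<pi>: "\<pi> \<in> \<P>" and nu: "\<nu> \<in> invariant_probs T"
    show "\<nu> \<in> LS weak_star (\<lambda>k. empirical_measure T x (\<pi> k))"
    proof (rule mem_LS_empirical_measureI[OF comp \<phi> dense pos[OF \<pi>]])
      show "\<nu> \<in> borel_probs" using nu by (simp add: invariant_probs_def)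
      fix n N :: nat
      \<comment> \<open>The list of rational approximations to the integrals of \<open>\<nu>\<close>
        lies in \<open>Q\<close> with \<open>\<nu>\<close> itself as witness. The approximation and
        the membership in \<open>U\<close> cost \<open>1 / Suc n\<close> each, hence the tolerance
        \<open>2 / Suc n\<close>.\<close>
      have "\<exists>a. \<bar>integral\<^sup>L \<nu> (\<phi> i) - of_rat a\<bar> < 1 / Suc n" for i
      proof -
        have "integral\<^sup>L \<nu> (\<phi> i) < integral\<^sup>L \<nu> (\<phi> i) + 1 / Suc n" by simp
        then obtain b where "integral\<^sup>L \<nu> (\<phi> i) < of_rat b" "of_rat b < integral\<^sup>L \<nu> (\<phi> i) + 1 / Suc n"
          using of_rat_dense by blast
        then show ?thesis by (intro exI[of _ b]) linarith
      qed
      then obtain a where a: "\<And>i. \<bar>integral\<^sup>L \<nu> (\<phi> i) - of_rat (a i)\<bar> < 1 / Suc n" by metis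
      define q where "q = map a [0..<n]"
      have len: "length q = n" and nth: "\<And>i. i < n \<Longrightarrow> q ! i = a i" by (auto simp: q_def)
      have "q \<in> Q" using nu a by (auto simp: Q_def close_def len nth)
      then have "x \<in> U (\<pi>, N, q)" using x \<pi> by (auto simp: \<U>_def)
      then obtain k where k: "N \<le> k"
        "\<And>i. i < n \<Longrightarrow> \<bar>birkhoff_average T (\<phi> i) (\<pi> k) x - of_rat (a i)\<bar> < 1 / Suc n"
        by (auto simp: U_def len nth)
      have "\<bar>birkhoff_average T (\<phi> i) (\<pi> k) x - integral\<^sup>L \<nu> (\<phi> i)\<bar> < 2 / Suc n" if "i < n" for i
      proof -
        have "2 / real (Suc n) = 1 / real (Suc n) + 1 / real (Suc n)" by simp
        then show ?thesis using k(2)[OF that] a[of i] by linarith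
      qed
      then show "\<exists>k\<ge>N. \<forall>i<n. \<bar>birkhoff_average T (\<phi> i) (\<pi> k) x - integral\<^sup>L \<nu> (\<phi> i)\<bar> < 2 / Suc n"
        using k(1) by blast
    qed
  qed
  moreover have "gdelta (\<Inter>\<U>)"
    using countable open_U by (intro gdelta_Inter_countable) (auto simp: \<U>_def)
  moreover have "closure (\<Inter>\<U>) = UNIV"
    using comp countable open_U dense_U
    by (intro closure_Inter_open_dense_compact) (auto simp: \<U>_def)
  ultimately show ?thesis unfolding residual_def by blast
qed

end
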